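(* Let $f$ be a root law (on $\mathfrak{R}$), $\sigma>0$ a constant, and $L\in\mathbb{R}^{A\times A}$ a Laplacian matrix. Let $x\in\mathbb{R}^{D\times A}$ be a one-hot encoding matrix. Then for any real number $s$, the vertically stacked matrix $\begin{pmatrix} x\\ sI\end{pmatrix}\in\mathbb{R}^{(D+A)\times A}$ (with $I$ the $A\times A$ identity) is a diffusion embedding, and $\mathrm{GBT}_{f,\sigma,x,L}$ is monotone.
   Context: **Alternatives and datasets.** $\mathcal{A}=\{1,\dots,A\}$ is a finite set of alternatives. $\mathfrak{R}\subseteq\mathbb{R}$ is the set of admissible comparison values, symmetric: $r\in\mathfrak{R}\iff -r\in\mathfrak{R}$. A comparison sample is a triple $(a,b,r)$ with $a\neq b$ in $\mathcal{A}$ and $r\in\mathfrak{R}$. Write $(a,b,r)\simeq(a',b',r')$ iff $(a',b',r')=(a,b,r)$ or $(a',b',r')=(b,a,-r)$. A dataset $\mathbf{D}$ is a finite list of comparison samples (repetitions allowed), of length $|\mathbf{D}|$, with $n$-th entry $\mathbf{D}_n=(a_n,b_n,r_n)$. $\mathcal{D}$ is the set of all datasets. **Operations on datasets.** - Exchange$_n$: replaces the $n$-th entry $(a_n,b_n,r_n)$, if it exists, by $(b_n,a_n,-r_n)$. - Shuffle$_{N,\sigma}$ ($\sigma$ a permutation of $\{1,\dots,N\}$): reorders the first $N$ entries according to $\sigma$ if $|\mathbf{D}|\ge N$; otherwise leaves $\mathbf{D}$ unchanged. - Append$_{a,b,r}$: appends the sample $(a,b,r)$ at the end of the list. It definitely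 favors $a'$ over $b'$ if $\mathfrak{R}$ has a maximum and $(a,b,r)\simeq(a',b',\max\mathfrak{R})$ (if $\mathfrak{R}$ has no maximum, no append definitely favors anything). - Update$_{n,r}$ ($r\in\mathfrak{R}$): replaces the comparison value $r_n$ of the $n$-th entry (if it exists) by $r$. It favors $a$ over $b$ if either $(a_n,b_n)=(a,b)$ and $r\ge r_n$, or $(a_n,b_n)=(b,a)$ and $r\le r_n$. An operation favors $a$ if it is a composition of exchanges, shuffles, appends that definitely favor $a$ over some other alternative, and updates that favor $a$ over some other alternative (each evaluated on the dataset to which it is applied). Write $\mathbf{D}\preceq_a\mathbf{D}'$ if $\mathbf{D}'=o(\mathbf{D})$ for some operation $o$ favoring $a$. **Monotonicity.** A preference learning algorithm $\mathrm{Alg}:\mathcal{D}\to\mathbb{R}^{A}$ is monotone if for every $a\in\mathcal{A}$ and all datasets, $\mathbf{D}\preceq_a\mathbf{D}'$ implies $\mathrm{Alg}(\mathbf{D})_a\le\mathrm{Alg}(\mathbf{D}')_a$. **Root law.** A root law $f$ is a probability distribution on $\mathfrak{R}$ with finite exponential moments, i.e. $\int_{\mathfrak{R}}e^{r\theta}\,df(r)<\infty$ for all $\theta\in\mathbb{R}$; $\Phi_f(\theta)=\log\int_{\mathfrak{R}}e^{r\theta}\,df(r)$ is its cumulant-generating function. **Laplacian matrix.** A real $A\times A$ matrix $L$ with $L_{ab}=L_{ba}\le 0$ for all $a\ne b$ and $L_{aa}=\sum_{b\ne a}|L_{ab}|$. **Model.** An embedding is a matrix $x\in\mathbb{R}^{D\times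 A}$ ($D\ge1$) with columns $x_a\in\mathbb{R}^D$, $a\in\mathcal{A}$. For $\beta\in\mathbb{R}^D$ put $\theta_a(\beta)=x_a^T\beta$. Define $$\mathcal{L}(\beta\mid\mathbf{D})=\frac{1}{2\sigma^2}\sum_{d}\beta_d^2+\frac12\sum_{a,b\in\mathcal{A}}\theta_a(\beta)L_{ab}\theta_b(\beta)+\sum_{(a,b,r)\in\mathbf{D}}\Big(\Phi_f\big((x_a-x_b)^T\beta\big)-r\,(x_a-x_b)^T\beta\Big),$$ the last sum running over all entries of $\mathbf{D}$ with multiplicity. This is strongly convex; let $\beta^*(\mathbf{D})$ be its unique minimizer, and $\mathrm{GBT}_{f,\sigma,x,L}(\mathbf{D})=x^T\beta^*(\mathbf{D})\in\mathbb{R}^A$. **Diffusion embedding.** A super-Laplacian matrix is a symmetric real matrix $\Delta$ with $\Delta_{ab}\le0$ for all $a\neq b$ and $\Delta_{aa}>-\sum_{b\ne a}\Delta_{ab}$ for all $a$. An embedding $x$ is a diffusion embedding if for every $\lambda>0$ the inverse of $x^Tx+\lambda I$ is super-Laplacian. **One-hot encoding.** The alternatives are partitioned into disjoint classes indexed by $d\in\{1,\dots,D\}$ (each alternative belongs to exactly one class); the one-hot encoding matrix $x\in\mathbb{R}^{D\times A}$ has $x_{da}=1$ if $a$ belongs to class $d$ and $x_{da}=0$ otherwise.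
   Formalization: The root law f is additionally assumed symmetric (invariant under r ↦ -r); without this the claim is false, e.g. f = δ_1 on {-1,1} with x = I, L = 0, where an exchange changes the scores from (0,0) to (2,-2). *)

theory Defs
  imports "HOL-Probability.Probability" "HOL-Combinatorics.Permutations"
begin

section \<open>Datasets and operations on them\<close>

text \<open>The alternatives are the elements of a finite type \<open>'a\<close>, and \<open>R\<close> is the set of
  admissible comparison values.\<close>

type_synonym 'a sample = "'a \<times> 'a \<times> real"
type_synonym 'a dataset = "'a sample list"

definition samples :: "real set \<Rightarrow> 'a sample set" where
  "samples R = {(a, b, r). a \<noteq> b \<and> r \<in> R}"

definition datasets :: "real set \<Rightarrow> 'a dataset set" where
  "datasets R = lists (samples R)"

definition symmetric_values :: "real set \<Rightarrow> bool" where
  "symmetric_values R \<longleftrightarrow> (\<forall>r. r \<in> R \<longleftrightarrow> - r \<in> R)"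

fun swap_sample :: "'a sample \<Rightarrow> 'a sample" where
  "swap_sample (a, b, r) = (b, a, - r)"

definition equiv_sample :: "'a sample \<Rightarrow> 'a sample \<Rightarrow> bool" where
  "equiv_sample s s' \<longleftrightarrow> s' = s \<or> s' = swap_sample s"

text \<open>Entries are numbered from 0, following the list library.\<close>

definition exchange :: "nat \<Rightarrow> 'a dataset \<Rightarrow> 'a dataset" where
  "exchange n D = (if n < length D then D[n := swap_sample (D ! n)] else D)"

definition shuffle :: "nat \<Rightarrow> (nat \<Rightarrow> nat) \<Rightarrow> 'a dataset \<Rightarrow> 'a dataset" where
  "shuffle N p D = (if N \<le> length D then permute_list p (take N D) @ drop N D else D)"

definition append_sample :: "'a sample \<Rightarrow> 'a dataset \<Rightarrow> 'a dataset" where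
  "append_sample s D = D @ [s]"

definition update_value :: "nat \<Rightarrow> real \<Rightarrow> 'a dataset \<Rightarrow> 'a dataset" where
  "update_value n r D =
    (if n < length D then D[n := (fst (D ! n), fst (snd (D ! n)), r)] else D)"

definition append_definitely_favors :: "real set \<Rightarrow> 'a sample \<Rightarrow> 'a \<Rightarrow> 'a \<Rightarrow> bool" where
  "append_definitely_favors R s a b \<longleftrightarrow>
    (\<exists>m\<in>R. (\<forall>r\<in>R. r \<le> m) \<and> equiv_sample s (a, b, m))"

definition update_favors :: "'a dataset \<Rightarrow> nat \<Rightarrow> real \<Rightarrow> 'a \<Rightarrow> 'a \<Rightarrow> bool" where
  "update_favors D n r a b \<longleftrightarrow> n < length D \<and>
    (case D ! n of (c, d, r\<^sub>n) \<Rightarrow> (c, d) = (a, b) \<and> r \<ge> r\<^sub>n \<or> (c, d) = (b, a) \<and> r \<le> r\<^sub>n)"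

text \<open>\<open>favored_le R a D D'\<close>: \<open>D'\<close> arises from \<open>D\<close> by a composition of basic operations
  favoring \<open>a\<close>, where each one is judged on the dataset to which it is applied.\<close>

inductive favored_le :: "real set \<Rightarrow> 'a \<Rightarrow> 'a dataset \<Rightarrow> 'a dataset \<Rightarrow> bool"
  for R :: "real set" and a :: 'a where
  refl: "favored_le R a D D"
| exchange: "favored_le R a D D' \<Longrightarrow> favored_le R a D (exchange n D')"
| shuffle: "favored_le R a D D' \<Longrightarrow> p permutes {..<N} \<Longrightarrow> favored_le R a D (shuffle N p D')"
| append: "favored_le R a D D' \<Longrightarrow> s \<in> samples R \<Longrightarrow> b \<noteq> a \<Longrightarrow>
    append_definitely_favors R s a b \<Longrightarrow> favored_le R a D (append_sample s D')"
| update: "favored_le R a D D' \<Longrightarrow> r \<in> R \<Longrightarrow> b \<noteq> a \<Longrightarrow>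
    update_favors D' n r a b \<Longrightarrow> favored_le R a D (update_value n r D')"

definition monotone_alg :: "real set \<Rightarrow> ('a dataset \<Rightarrow> real ^ 'a) \<Rightarrow> bool" where
  "monotone_alg R Alg \<longleftrightarrow>
    (\<forall>a. \<forall>D\<in>datasets R. \<forall>D'\<in>datasets R. favored_le R a D D' \<longrightarrow> Alg D $ a \<le> Alg D' $ a)"


section \<open>Root laws\<close>

text \<open>A law on \<open>R\<close> is a probability measure on the trace on \<open>R\<close> of the Borel sigma-algebra,
  so that \<open>space f = R\<close>.\<close>

definition root_law :: "real set \<Rightarrow> real measure \<Rightarrow> bool" where
  "root_law R f \<longleftrightarrow> prob_space f \<and> sets f = sets (restrict_space borel R) \<and>
    (\<forall>\<theta>. integrable f (\<lambda>r. exp (r * \<theta>)))"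

text \<open>Symmetry of \<open>f\<close> makes the cumulant-generating function even. Without it, the loss below
  may change when \<open>(a, b, r)\<close> is exchanged for \<open>(b, a, - r)\<close>. Since exchanges are involutions
  that favor every alternative, a monotone algorithm must be invariant under them.\<close>

definition symmetric_law :: "real measure \<Rightarrow> bool" where
  "symmetric_law f \<longleftrightarrow> distr f f uminus = f"

definition cgf :: "real measure \<Rightarrow> real \<Rightarrow> real" where
  "cgf f \<theta> = ln (\<integral>r. exp (r * \<theta>) \<partial>f)"


section \<open>The model\<close>

text \<open>An embedding is a matrix \<open>x :: real ^ 'a ^ 'd\<close> whose columns are the vectors of the
  alternatives.\<close>

definition laplacian :: "real ^ 'a ^ 'a \<Rightarrow> bool" where
  "laplacian L \<longleftrightarrow> (\<forall>a b. a \<noteq> b \<longrightarrow> L $ a $ b = L $ b $ a \<and> L $ a $ b \<le> 0) \<and>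
    (\<forall>a. L $ a $ a = (\<Sum>b\<in>UNIV - {a}. \<bar>L $ a $ b\<bar>))"

definition gbt_loss :: "real measure \<Rightarrow> real \<Rightarrow> real ^ 'a ^ 'd \<Rightarrow> real ^ 'a ^ 'a
    \<Rightarrow> 'a dataset \<Rightarrow> real ^ 'd \<Rightarrow> real" where
  "gbt_loss f \<sigma> x L D \<beta> =
    1 / (2 * \<sigma>\<^sup>2) * (\<Sum>d\<in>UNIV. (\<beta> $ d)\<^sup>2)
    + 1 / 2 * (\<Sum>a\<in>UNIV. \<Sum>b\<in>UNIV. (column a x \<bullet> \<beta>) * L $ a $ b * (column b x \<bullet> \<beta>))
    + (\<Sum>(a, b, r)\<leftarrow>D. cgf f ((column a x - column b x) \<bullet> \<beta>)
                        - r * ((column a x - column b x) \<bullet> \<beta>))"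

definition gbt_minimizer :: "real measure \<Rightarrow> real \<Rightarrow> real ^ 'a ^ 'd \<Rightarrow> real ^ 'a ^ 'a
    \<Rightarrow> 'a dataset \<Rightarrow> real ^ 'd" where
  "gbt_minimizer f \<sigma> x L D = (THE \<beta>. \<forall>\<beta>'. gbt_loss f \<sigma> x L D \<beta> \<le> gbt_loss f \<sigma> x L D \<beta>')"

definition GBT :: "real measure \<Rightarrow> real \<Rightarrow> real ^ 'a ^ 'd \<Rightarrow> real ^ 'a ^ 'a
    \<Rightarrow> 'a dataset \<Rightarrow> real ^ 'a" where
  "GBT f \<sigma> x L D = transpose x *v gbt_minimizer f \<sigma> x L D"


section \<open>Diffusion embeddings and one-hot encodings\<close>

definition super_laplacian :: "real ^ 'a ^ 'a \<Rightarrow> bool" where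
  "super_laplacian M \<longleftrightarrow> transpose M = M \<and> (\<forall>a b. a \<noteq> b \<longrightarrow> M $ a $ b \<le> 0) \<and>
    (\<forall>a. M $ a $ a > - (\<Sum>b\<in>UNIV - {a}. M $ a $ b))"

definition diffusion_embedding :: "real ^ 'a ^ 'd \<Rightarrow> bool" where
  "diffusion_embedding x \<longleftrightarrow>
    (\<forall>\<mu>>0. invertible (transpose x ** x + \<mu> *\<^sub>R mat 1) \<and>
           super_laplacian (matrix_inv (transpose x ** x + \<mu> *\<^sub>R mat 1)))"

text \<open>The function \<open>c\<close> maps each alternative to its class; classes may be empty.\<close>

definition one_hot :: "real ^ 'a ^ 'd \<Rightarrow> bool" where
  "one_hot x \<longleftrightarrow> (\<exists>c. \<forall>d a. x $ d $ a = (if c a = d then 1 else 0))"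

text \<open>Vertical stacking: the rows are indexed by the sum of the two row types.\<close>

definition vstack :: "real ^ 'a ^ 'm \<Rightarrow> real ^ 'a ^ 'n \<Rightarrow> real ^ 'a ^ ('m + 'n)" where
  "vstack x y = (\<chi> i. case i of Inl j \<Rightarrow> x $ j | Inr k \<Rightarrow> y $ k)"

end

theory Submission
  imports Defs
begin

text \<open>
  Write \<open>c a\<close> for the class of the alternative \<open>a\<close>. Under a one-hot encoding the score of \<open>a\<close> is the
  coordinate \<open>\<beta> $ c a\<close>, and since the Laplacian form is a sum of squares of score differences, the
  loss becomes a sum of \<^emph>\<open>convex functions of single coordinates and of differences of two
  coordinates\<close> of \<open>\<beta>\<close>. For smooth functions this says that the Hessian is a symmetric,
  diagonally dominant matrix with nonpositive off-diagonal entries; its inverse then has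
  nonnegative entries, each row being largest on the diagonal. Hence pushing the difference of
  two coordinates upwards raises the first of them, and this is monotonicity.

  The proof below replaces the Hessian by an inequality between finite displacements. If \<open>v\<close> and
  \<open>w\<close> are two points and the excess of \<open>v\<close> over \<open>w\<close>, clipped to the interval from \<open>0\<close> to \<open>t\<close>, is
  moved from \<open>v\<close> to \<open>w\<close>, then the total loss of the two points does not increase
  (\<open>transfer_stable_coord\<close>, \<open>transfer_stable_difference\<close>). This yields a comparison of minimizers
  (\<open>minimizer_coord_mono\<close>): adding an antitone function of \<open>\<beta> $ i - \<beta> $ j\<close> to the loss cannot lower
  coordinate \<open>i\<close> of its minimizer. Existence and uniqueness of minimizers follow from the quadratic
  regularization and convexity (\<open>quadratic_plus_convex_ex1_minimizer\<close>).

  It remains to see that every operation in favor of \<open>a\<close> either preserves the loss or changes it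
  in this way. For an append with the maximal value \<open>m\<close> this is \<open>cgf_minus_max_antimono\<close>; for an
  update the change is linear; exchanges preserve the loss because a symmetric law has an even
  cumulant-generating function.

  The claim on diffusion embeddings is an explicit matrix inversion, possible because the Gram
  matrix of a one-hot encoding is block diagonal with all-ones blocks.
\<close>


section \<open>Transfers between two points and comparison of minimizers\<close>

text \<open>Where \<open>v\<close> exceeds \<open>w\<close>, the excess, capped at \<open>t\<close>, is what will be handed over from \<open>v\<close> to
  \<open>w\<close>. The cap is what makes a coordinate with excess exactly \<open>t\<close> and one with a larger excess
  receive the same amount, so that their difference in \<open>w\<close> does not change.\<close>

definition transfer :: "real \<Rightarrow> real ^ 'd \<Rightarrow> real ^ 'd \<Rightarrow> real ^ 'd" where
  "transfer t v w = (\<chi> i. min t (max 0 (v $ i - w $ i)))"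

text \<open>A relative of the exchange inequalities of \<open>L\<^sup>\<natural>\<close>-convex analysis. It replaces the sign
  pattern of the Hessian (a symmetric, diagonally dominant matrix with nonpositive off-diagonal
  entries) and needs no derivatives.\<close>

definition transfer_stable :: "(real ^ 'd \<Rightarrow> real) \<Rightarrow> bool" where
  "transfer_stable F \<longleftrightarrow>
    (\<forall>t\<ge>0. \<forall>v w. F (v - transfer t v w) + F (w + transfer t v w) \<le> F v + F w)"

lemma transfer_stable_const: "transfer_stable (\<lambda>\<beta>. k)"
  by (simp add: transfer_stable_def)

lemma transfer_stable_add:
  assumes "transfer_stable F" "transfer_stable G"
  shows "transfer_stable (\<lambda>\<beta>. F \<beta> + G \<beta>)"
  unfolding transfer_stable_def
proof (intro allI impI)
  fix t :: real and v w :: "real ^ 'a" assume t: "0 \<le> t"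
  show "F (v - transfer t v w) + G (v - transfer t v w)
      + (F (w + transfer t v w) + G (w + transfer t v w)) \<le> F v + G v + (F w + G w)"
    using assms[unfolded transfer_stable_def, rule_format, OF t, of v w] by linarith
qed

lemma transfer_stable_sum:
  assumes "\<And>i. i \<in> I \<Longrightarrow> transfer_stable (F i)"
  shows "transfer_stable (\<lambda>\<beta>. \<Sum>i\<in>I. F i \<beta>)"
  using assms
  by (induction I rule: infinite_finite_induct)
    (simp_all add: transfer_stable_add transfer_stable_const)

lemma transfer_stable_sum_list:
  assumes "\<And>s. s \<in> set D \<Longrightarrow> transfer_stable (F s)"
  shows "transfer_stable (\<lambda>\<beta>. \<Sum>s\<leftarrow>D. F s \<beta>)"
  using assms by (induction D) (simp_all add: transfer_stable_add transfer_stable_const)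

text \<open>Moving two points towards each other while keeping their sum does not raise the total of a
  convex function, because both new points are convex combinations of the old ones with swapped
  weights.\<close>

lemma convex_exchange:
  fixes g :: "real \<Rightarrow> real"
  assumes g: "convex_on UNIV g" and p: "min a b \<le> p" "p \<le> max a b"
  shows "g p + g (a + b - p) \<le> g a + g b"
proof (cases "a = b")
  case True
  then show ?thesis using p by simp
next
  case False
  define u where "u = (p - b) / (a - b)"
  have u: "0 \<le> u" "u \<le> 1"
    using p False by (auto simp: u_def min_def max_def divide_simps split: if_splits)
  have pu: "p = u * a + (1 - u) * b"
  proof -
    have "u * (a - b) = p - b" using False by (simp add: u_def)
    then show ?thesis by (simp add: algebra_simps)
  qed
  have "g (u * a + (1 - u) * b) \<le> u * g a + (1 - u) * g b"
    using convex_onD[OF g, of u b a] u by (simp add: add.commute)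
  moreover have "g (u * b + (1 - u) * a) \<le> u * g b + (1 - u) * g a"
    using convex_onD[OF g, of u a b] u by (simp add: add.commute)
  moreover have "a + b - p = u * b + (1 - u) * a"
    unfolding pu by (simp add: algebra_simps)
  ultimately show ?thesis unfolding pu by (simp add: algebra_simps)
qed

text \<open>The clipped excess lies between \<open>0\<close> and the excess itself, so the transfer moves the two values of
  each coordinate towards each other.\<close>

lemma transfer_stable_coord:
  assumes "convex_on UNIV g"
  shows "transfer_stable (\<lambda>\<beta>. g (\<beta> $ i))"
  unfolding transfer_stable_def
proof (intro allI impI)
  fix t :: real and v w :: "real ^ 'a" assume t: "0 \<le> t"
  let ?p = "(w + transfer t v w) $ i"
  have p: "min (w $ i) (v $ i) \<le> ?p" "?p \<le> max (w $ i) (v $ i)"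
    using t by (auto simp: transfer_def min_def max_def)
  have eq: "w $ i + v $ i - ?p = (v - transfer t v w) $ i" by simp
  show "g ((v - transfer t v w) $ i) + g ?p \<le> g (v $ i) + g (w $ i)"
    using convex_exchange[OF assms p] unfolding eq by linarith
qed

text \<open>Clipping is monotone and 1-Lipschitz as a function of the excess, so the transfer also moves
  the two values of each difference of coordinates towards each other.\<close>

lemma transfer_stable_difference:
  assumes "convex_on UNIV g"
  shows "transfer_stable (\<lambda>\<beta>. g (\<beta> $ i - \<beta> $ j))"
  unfolding transfer_stable_def
proof (intro allI impI)
  fix t :: real and v w :: "real ^ 'a" assume t: "0 \<le> t"
  let ?p = "(w + transfer t v w) $ i - (w + transfer t v w) $ j"
  let ?a = "w $ i - w $ j" and ?b = "v $ i - v $ j"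
  have p: "min ?a ?b \<le> ?p" "?p \<le> max ?a ?b"
    using t by (auto simp: transfer_def min_def max_def)
  have eq: "?a + ?b - ?p = (v - transfer t v w) $ i - (v - transfer t v w) $ j" by simp
  show "g ((v - transfer t v w) $ i - (v - transfer t v w) $ j) + g ?p \<le> g ?b + g ?a"
    using convex_exchange[OF assms p] unfolding eq by linarith
qed

text \<open>The comparison principle. Suppose that coordinate \<open>i\<close> of the minimizer dropped by \<open>t > 0\<close>. If
  coordinate \<open>j\<close> dropped by less, the difference of the two coordinates became smaller, which the
  antitone term \<open>h\<close> penalizes: then \<open>w\<close> cannot beat \<open>v\<close> under the new objective unless it ties
  with \<open>v\<close> under the old one, and then the two points coincide. If coordinate \<open>j\<close> dropped by at
  least \<open>t\<close>, a transfer capped at \<open>t\<close> raises both coordinates of \<open>w\<close> by exactly \<open>t\<close>, so \<open>h\<close> does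
  not notice it, and the exchange inequality produces a second minimizer of \<open>F\<close>. The case \<open>i = j\<close> occurs when two compared
  alternatives belong to the same class.\<close>

lemma minimizer_coord_mono:
  fixes F :: "real ^ 'd \<Rightarrow> real" and h :: "real \<Rightarrow> real"
  assumes F: "transfer_stable F" and h: "antimono h"
    and v_unique: "\<And>\<beta>. F \<beta> \<le> F v \<Longrightarrow> \<beta> = v"
    and w: "\<And>\<beta>. F w + h (w $ i - w $ j) \<le> F \<beta> + h (\<beta> $ i - \<beta> $ j)"
  shows "v $ i \<le> w $ i"
proof (rule ccontr)
  assume "\<not> v $ i \<le> w $ i"
  define t where "t = v $ i - w $ i"
  have t: "t > 0" using \<open>\<not> v $ i \<le> w $ i\<close> by (simp add: t_def)
  have j: "t \<le> v $ j - w $ j"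
  proof (rule ccontr)
    assume "\<not> t \<le> v $ j - w $ j"
    then have "h (v $ i - v $ j) \<le> h (w $ i - w $ j)"
      by (intro antimonoD[OF h]) (simp add: t_def)
    then have "F w \<le> F v" using w[of v] by linarith
    then have "w = v" by (rule v_unique)
    then show False using t by (simp add: t_def)
  qed
  \<comment> \<open>Both coordinates now have an excess of at least \<open>t\<close>, so the cap is active for both.\<close>
  let ?v = "v - transfer t v w" and ?w = "w + transfer t v w"
  have at: "transfer t v w $ i = t" "transfer t v w $ j = t"
    using t j by (simp_all add: transfer_def flip: t_def)
  have "F ?v + F ?w \<le> F v + F w"
    using F[unfolded transfer_stable_def] t by (blast intro: less_imp_le)
  moreover have "F w \<le> F ?w"
    using w[of ?w] unfolding vector_add_component at by simp
  ultimately have "F ?v \<le> F v" by linarith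
  then have "?v = v" by (rule v_unique)
  then have "?v $ i = v $ i" by (rule arg_cong)
  then show False using t unfolding vector_minus_component at by simp
qed


section \<open>Minimizers of a quadratic plus a convex function\<close>

text \<open>A convex function is bounded below by an affine function of the norm (compare a far point with
  the origin and the unit ball), so the quadratic term makes the sum coercive and confines the
  search to a compact ball. Uniqueness comes from the midpoint of two minimizers and the
  parallelogram law.\<close>

lemma quadratic_plus_convex_ex1_minimizer:
  fixes C :: "'v::euclidean_space \<Rightarrow> real"
  assumes C: "convex_on UNIV C" and k: "k > 0"
  defines "F \<equiv> \<lambda>\<beta>. k * (norm \<beta>)\<^sup>2 + C \<beta>"
  shows "\<exists>!v. \<forall>\<beta>. F v \<le> F \<beta>"
proof -
  have contC: "continuous_on UNIV C"
    by (rule convex_on_continuous[OF open_UNIV C])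
  have contF: "continuous_on S F" for S
    unfolding F_def
    by (intro continuous_on_add continuous_on_mult continuous_on_const continuous_on_power
      continuous_on_norm_id continuous_on_subset[OF contC]) auto
  have "\<exists>z\<in>cball 0 1. \<forall>y\<in>cball 0 1. C z \<le> C y"
    by (intro continuous_attains_inf continuous_on_subset[OF contC]) auto
  then obtain z where z: "\<And>y. y \<in> cball 0 1 \<Longrightarrow> C z \<le> C y" by blast
  define K where "K = C 0 - C z"
  have lower: "C 0 - K * norm \<beta> \<le> C \<beta>" if "norm \<beta> \<ge> 1" for \<beta>
  proof -
    let ?u = "1 / norm \<beta>"
    have u: "0 \<le> ?u" "?u \<le> 1" "norm \<beta> * ?u = 1"
      using that by (auto simp: divide_le_eq)
    have "C z \<le> C (?u *\<^sub>R \<beta>)" using that by (intro z) auto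
    also have "\<dots> = C ((1 - ?u) *\<^sub>R 0 + ?u *\<^sub>R \<beta>)" by (simp only: scaleR_zero_right add_0)
    also have "\<dots> \<le> (1 - ?u) * C 0 + ?u * C \<beta>" by (intro convex_onD[OF C] u) auto
    finally have "norm \<beta> * C z \<le> norm \<beta> * ((1 - ?u) * C 0 + ?u * C \<beta>)"
      using that by (intro mult_left_mono) auto
    also have "\<dots> = (norm \<beta> - norm \<beta> * ?u) * C 0 + (norm \<beta> * ?u) * C \<beta>" by algebra
    also have "\<dots> = (norm \<beta> - 1) * C 0 + C \<beta>" by (simp only: u(3) mult_1)
    finally show ?thesis by (simp add: K_def algebra_simps)
  qed
  \<comment> \<open>Beyond \<open>K / k\<close> the quadratic term outweighs the linear loss of the lower bound.\<close>
  define \<rho> where "\<rho> = max 1 (K / k)"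
  have zero: "0 \<in> cball (0::'v) \<rho>" by (simp add: \<rho>_def)
  then have "\<exists>v\<in>cball 0 \<rho>. \<forall>y\<in>cball 0 \<rho>. F v \<le> F y"
    by (intro continuous_attains_inf contF) auto
  then obtain v where v: "\<And>y. y \<in> cball 0 \<rho> \<Longrightarrow> F v \<le> F y" by blast
  have min: "F v \<le> F \<beta>" for \<beta>
  proof (cases "\<beta> \<in> cball 0 \<rho>")
    case False
    then have n: "norm \<beta> \<ge> 1" "K / k \<le> norm \<beta>" by (auto simp: \<rho>_def)
    have "K * norm \<beta> \<le> (k * norm \<beta>) * norm \<beta>"
      using n k by (intro mult_right_mono) (auto simp: field_simps)
    then have "F 0 \<le> F \<beta>"
      using lower[OF n(1)] by (simp add: F_def power2_eq_square)
    then show ?thesis using v[OF zero] by linarith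
  qed (rule v)
  show ?thesis
  proof (rule ex1I[of _ v])
    show "\<forall>\<beta>. F v \<le> F \<beta>" using min by blast
    fix w assume w: "\<forall>\<beta>. F w \<le> F \<beta>"
    let ?m = "(1/2) *\<^sub>R v + (1/2) *\<^sub>R w"
    have C_mid: "C ?m \<le> 1 / 2 * C v + 1 / 2 * C w"
      using convex_onD[OF C, of "1 / 2" v w] by simp
    have "(norm ?m)\<^sup>2 = (norm v)\<^sup>2 / 2 + (norm w)\<^sup>2 / 2 - (norm (v - w))\<^sup>2 / 4"
      unfolding power2_norm_eq_inner inner_add_left inner_add_right inner_diff_left
        inner_diff_right inner_scaleR_left inner_scaleR_right inner_commute[of w v]
      by (simp add: field_simps)
    then have "F ?m = k * ((norm v)\<^sup>2 / 2 + (norm w)\<^sup>2 / 2 - (norm (v - w))\<^sup>2 / 4) + C ?m"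
      by (simp only: F_def)
    also have "\<dots> \<le> F v / 2 + F w / 2 - k * (norm (v - w))\<^sup>2 / 4"
      using C_mid unfolding F_def distrib_left right_diff_distrib
      by (simp add: add_divide_distrib)
    finally have "F ?m \<le> F v / 2 + F w / 2 - k * (norm (v - w))\<^sup>2 / 4" .
    moreover have "F v = F w" by (rule order_antisym[OF min w[rule_format]])
    moreover have "F w \<le> F ?m" using w by blast
    ultimately have "k * (norm (v - w))\<^sup>2 \<le> 0" by linarith
    then show "w = v" using k by (simp add: mult_le_0_iff)
  qed
qed

lemma convex_on_difference:
  assumes "convex_on UNIV g"
  shows "convex_on UNIV (\<lambda>\<beta> :: real ^ 'd. g (\<beta> $ i - \<beta> $ j))"
proof (rule convex_onI)
  fix u :: real and v w :: "real ^ 'd" assume u: "0 < u" "u < 1"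
  have eq: "((1 - u) *\<^sub>R v + u *\<^sub>R w) $ i - ((1 - u) *\<^sub>R v + u *\<^sub>R w) $ j
      = (1 - u) *\<^sub>R (v $ i - v $ j) + u *\<^sub>R (w $ i - w $ j)"
    by (simp add: algebra_simps)
  show "g (((1 - u) *\<^sub>R v + u *\<^sub>R w) $ i - ((1 - u) *\<^sub>R v + u *\<^sub>R w) $ j)
      \<le> (1 - u) * g (v $ i - v $ j) + u * g (w $ i - w $ j)"
    unfolding eq using u by (intro convex_onD[OF assms]) auto
qed auto

lemma convex_on_pointwise_sum:
  assumes "\<And>i. i \<in> I \<Longrightarrow> convex_on UNIV (F i)"
  shows "convex_on UNIV (\<lambda>\<beta>. \<Sum>i\<in>I. F i \<beta> :: real)"
  using assms
  by (induction I rule: infinite_finite_induct) (simp_all add: convex_on_add convex_on_const)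

lemma convex_on_sum_list:
  assumes "\<And>s. s \<in> set D \<Longrightarrow> convex_on UNIV (F s)"
  shows "convex_on UNIV (\<lambda>\<beta>. \<Sum>s\<leftarrow>D. F s \<beta> :: real)"
  using assms by (induction D) (simp_all add: convex_on_add convex_on_const)

lemma convex_on_scaled_square:
  assumes "0 \<le> k" shows "convex_on UNIV (\<lambda>z :: real. k * z\<^sup>2)"
  using assms convex_power2 by (intro convex_on_cmul)

lemma power2_norm_vec: "(norm (\<beta> :: real ^ 'd))\<^sup>2 = (\<Sum>d\<in>UNIV. (\<beta> $ d)\<^sup>2)"
  unfolding power2_norm_eq_inner inner_vec_def by (simp add: power2_eq_square)


section \<open>The cumulant-generating function\<close>

lemma mgf_pos:
  assumes "root_law R f"
  shows "(\<integral>r. exp (r * \<theta>) \<partial>f) > 0"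
proof -
  interpret prob_space f using assms by (simp add: root_law_def)
  have int: "integrable f (\<lambda>r. exp (r * \<theta>))" using assms by (simp add: root_law_def)
  have "(\<integral>r. exp (r * \<theta>) \<partial>f) \<noteq> 0"
  proof
    assume "(\<integral>r. exp (r * \<theta>) \<partial>f) = 0"
    then have "AE r in f. exp (r * \<theta>) = 0"
      using integral_nonneg_eq_0_iff_AE[OF int] by simp
    then show False by simp
  qed
  moreover have "(\<integral>r. exp (r * \<theta>) \<partial>f) \<ge> 0" by simp
  ultimately show ?thesis by linarith
qed

text \<open>Tilting by \<open>exp (r * \<theta> - cgf f \<theta>)\<close> turns the law into a probability law for every \<open>\<theta>\<close>.
  Convexity of \<open>exp\<close>, applied pointwise to these normalized densities and integrated, is the
  required case of the Hoelder inequality.\<close>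

lemma cgf_convex:
  assumes f: "root_law R f"
  shows "convex_on UNIV (cgf f)"
proof (rule convex_onI)
  fix u \<theta> \<eta> :: real assume u: "0 < u" "u < 1"
  interpret prob_space f using f by (simp add: root_law_def)
  have int: "integrable f (\<lambda>r. exp (r * z))" for z using f by (simp add: root_law_def)
  have M: "exp (cgf f z) = (\<integral>r. exp (r * z) \<partial>f)" for z
    using mgf_pos[OF f] by (simp add: cgf_def)
  let ?A = "cgf f \<theta>" and ?B = "cgf f \<eta>" and ?\<zeta> = "(1 - u) * \<theta> + u * \<eta>"
  have tilt: "(\<integral>r. exp (r * z) * exp (- cgf f z) \<partial>f) = 1" for z
  proof -
    have "(\<integral>r. exp (r * z) * exp (- cgf f z) \<partial>f) = exp (cgf f z) * exp (- cgf f z)"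
      by (simp add: M)
    then show ?thesis by (simp flip: exp_add)
  qed
  have "exp (r * ?\<zeta>) * exp (- ((1 - u) * ?A + u * ?B))
      \<le> (1 - u) * (exp (r * \<theta>) * exp (- ?A)) + u * (exp (r * \<eta>) * exp (- ?B))" for r
  proof -
    have "exp ((1 - u) * (r * \<theta> - ?A) + u * (r * \<eta> - ?B))
        \<le> (1 - u) * exp (r * \<theta> - ?A) + u * exp (r * \<eta> - ?B)"
      using convex_onD[OF exp_convex, of u "r * \<theta> - ?A" "r * \<eta> - ?B"] u by simp
    then show ?thesis by (simp add: algebra_simps flip: exp_add)
  qed
  then have "(\<integral>r. exp (r * ?\<zeta>) * exp (- ((1 - u) * ?A + u * ?B)) \<partial>f)
      \<le> (\<integral>r. (1 - u) * (exp (r * \<theta>) * exp (- ?A)) + u * (exp (r * \<eta>) * exp (- ?B)) \<partial>f)"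
    by (intro integral_mono Bochner_Integration.integrable_add integrable_mult_right
      integrable_mult_left int)
  also have "\<dots> = (\<integral>r. (1 - u) * (exp (r * \<theta>) * exp (- ?A)) \<partial>f)
      + (\<integral>r. u * (exp (r * \<eta>) * exp (- ?B)) \<partial>f)"
    by (intro Bochner_Integration.integral_add integrable_mult_right integrable_mult_left int)
  also have "\<dots> = (1 - u) * 1 + u * 1"
    unfolding integral_mult_right_zero[of _ "1 - u"] integral_mult_right_zero[of _ u] tilt ..
  finally have "(\<integral>r. exp (r * ?\<zeta>) \<partial>f) * exp (- ((1 - u) * ?A + u * ?B)) \<le> 1"
    by simp
  then have "exp (cgf f ?\<zeta> - ((1 - u) * ?A + u * ?B)) \<le> 1"
    unfolding M[symmetric] by (simp only: exp_add[symmetric] diff_conv_add_uminus)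
  then have "cgf f ?\<zeta> \<le> (1 - u) * ?A + u * ?B"
    by (simp only: exp_le_one_iff diff_le_0_iff_le)
  then show "cgf f ((1 - u) *\<^sub>R \<theta> + u *\<^sub>R \<eta>) \<le> (1 - u) * ?A + u * ?B"
    by (simp only: real_scaleR_def)
qed auto

lemma convex_on_tilted_cgf:
  assumes "root_law R f"
  shows "convex_on UNIV (\<lambda>z. cgf f z - r * z)"
proof -
  have "convex_on UNIV (\<lambda>z :: real. - r * z)"
    by (rule convex_onI) (auto simp: algebra_simps)
  from convex_on_add[OF cgf_convex[OF assms] this] show ?thesis by simp
qed

lemma cgf_even:
  assumes R: "symmetric_values R" and f: "root_law R f" and sym: "symmetric_law f"
  shows "cgf f (- \<theta>) = cgf f \<theta>"
proof -
  have sets: "sets f = sets (restrict_space borel R)" using f by (simp add: root_law_def)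
  have "uminus \<in> restrict_space borel R \<rightarrow>\<^sub>M (restrict_space borel R :: real measure)"
    using R by (intro measurable_restrict_space3) (auto simp: symmetric_values_def)
  then have meas: "uminus \<in> f \<rightarrow>\<^sub>M f" using measurable_cong_sets[OF sets sets] by simp
  have "(\<integral>r. exp (r * \<theta>) \<partial>f) = (\<integral>r. exp (r * \<theta>) \<partial>(distr f f uminus))"
    using sym by (simp add: symmetric_law_def)
  also have "\<dots> = (\<integral>r. exp (- r * \<theta>) \<partial>f)"
    using meas f by (subst integral_distr)
      (auto simp: root_law_def intro: borel_measurable_integrable)
  finally show ?thesis by (simp add: cgf_def)
qed

text \<open>The function is the logarithm of the integral of \<open>exp ((r - m) * z)\<close>, and each exponent
  \<open>(r - m) * z\<close> is antitone in \<open>z\<close>. This is why a comparison with the maximal value can only help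
  the alternative that it favors, whatever the current scores are.\<close>

lemma cgf_minus_max_antimono:
  assumes f: "root_law R f" and m: "\<And>r. r \<in> R \<Longrightarrow> r \<le> m"
  shows "antimono (\<lambda>z. cgf f z - m * z)"
proof (rule antimonoI)
  fix y z :: real assume "y \<le> z"
  interpret prob_space f using f by (simp add: root_law_def)
  have int: "integrable f (\<lambda>r. exp (r * z))" for z using f by (simp add: root_law_def)
  have "space f = R" 
    using f sets_eq_imp_space_eq[of f "restrict_space borel R"]
    by (simp add: root_law_def space_restrict_space)
  then have "exp (r * z) \<le> exp (m * (z - y)) * exp (r * y)" if "r \<in> space f" for r
    using mult_right_mono[OF m[of r], of "z - y"] \<open>y \<le> z\<close> that
    by (simp add: algebra_simps flip: exp_add)
  then have "(\<integral>r. exp (r * z) \<partial>f) \<le> (\<integral>r. exp (m * (z - y)) * exp (r * y) \<partial>f)"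
    using int by (intro integral_mono) auto
  then have "(\<integral>r. exp (r * z) \<partial>f) \<le> exp (m * (z - y)) * (\<integral>r. exp (r * y) \<partial>f)" by simp
  then have "ln (\<integral>r. exp (r * z) \<partial>f) \<le> ln (exp (m * (z - y)) * (\<integral>r. exp (r * y) \<partial>f))"
    using mgf_pos[OF f] by (subst ln_le_cancel_iff) auto
  then have "cgf f z \<le> m * (z - y) + cgf f y"
    using mgf_pos[OF f, of y] by (simp add: cgf_def ln_mult)
  then show "cgf f z - m * z \<le> cgf f y - m * y" by (simp add: algebra_simps)
qed


section \<open>The loss in the coordinates of the classes\<close>

text \<open>The Dirichlet form of a weighted graph. The rows and columns of \<open>L\<close> sum to zero, so adding
  multiples of the squares of the \<open>\<theta> a\<close> changes nothing and completes the square. The absolute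
  values keep the coefficients nonnegative on the diagonal as well, where the square vanishes.\<close>

lemma laplacian_quadratic_form:
  fixes L :: "real ^ 'a ^ 'a" and \<theta> :: "'a \<Rightarrow> real"
  assumes L: "laplacian L"
  shows "1 / 2 * (\<Sum>a\<in>UNIV. \<Sum>b\<in>UNIV. \<theta> a * L $ a $ b * \<theta> b)
    = (\<Sum>a\<in>UNIV. \<Sum>b\<in>UNIV. \<bar>L $ a $ b\<bar> / 4 * (\<theta> a - \<theta> b)\<^sup>2)"
proof -
  have nonpos: "L $ a $ b \<le> 0" if "a \<noteq> b" for a b using L that by (simp add: laplacian_def)
  have sym: "L $ a $ b = L $ b $ a" for a b
    using L unfolding laplacian_def by (cases "a = b") auto
  have row: "(\<Sum>b\<in>UNIV. L $ a $ b) = 0" for a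
  proof -
    have "L $ a $ a = (\<Sum>b\<in>UNIV - {a}. \<bar>L $ a $ b\<bar>)" using L by (simp add: laplacian_def)
    also have "\<dots> = (\<Sum>b\<in>UNIV - {a}. - L $ a $ b)"
      using nonpos by (intro sum.cong) auto
    finally show ?thesis by (simp add: sum.remove[of UNIV a] sum_negf)
  qed
  have rows: "(\<Sum>a\<in>UNIV. \<Sum>b\<in>UNIV. L $ a $ b * (\<theta> a)\<^sup>2) = 0"
    by (simp add: row flip: sum_distrib_right)
  have columns: "(\<Sum>a\<in>UNIV. \<Sum>b\<in>UNIV. L $ a $ b * (\<theta> b)\<^sup>2) = 0"
    using rows by (subst sum.swap) (simp add: sym)
  have "(\<Sum>a\<in>UNIV. \<Sum>b\<in>UNIV. \<bar>L $ a $ b\<bar> / 4 * (\<theta> a - \<theta> b)\<^sup>2)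
      = (\<Sum>a\<in>UNIV. \<Sum>b\<in>UNIV. 1 / 2 * (\<theta> a * L $ a $ b * \<theta> b)
          - (L $ a $ b * (\<theta> a)\<^sup>2) / 4 - (L $ a $ b * (\<theta> b)\<^sup>2) / 4)"
  proof (intro sum.cong HOL.refl)
    fix a b :: 'a
    show "\<bar>L $ a $ b\<bar> / 4 * (\<theta> a - \<theta> b)\<^sup>2 = 1 / 2 * (\<theta> a * L $ a $ b * \<theta> b)
          - (L $ a $ b * (\<theta> a)\<^sup>2) / 4 - (L $ a $ b * (\<theta> b)\<^sup>2) / 4"
      using nonpos[of a b]
      by (cases "a = b") (auto simp: power2_eq_square field_simps)
  qed
  also have "\<dots> = 1 / 2 * (\<Sum>a\<in>UNIV. \<Sum>b\<in>UNIV. \<theta> a * L $ a $ b * \<theta> b)"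
    using rows columns
    by (simp add: sum_subtractf flip: sum_divide_distrib sum_distrib_left)
  finally show ?thesis by simp
qed

text \<open>The contribution of one sample to the loss, in the coordinates \<open>\<beta>\<close> of the classes: under a
  one-hot encoding the score of \<open>a\<close> is the coordinate of its class \<open>c a\<close>.\<close>

definition sample_loss :: "real measure \<Rightarrow> ('a \<Rightarrow> 'd) \<Rightarrow> 'a sample \<Rightarrow> real ^ 'd \<Rightarrow> real" where
  "sample_loss f c s \<beta> = (case s of (a, b, r) \<Rightarrow>
    cgf f (\<beta> $ c a - \<beta> $ c b) - r * (\<beta> $ c a - \<beta> $ c b))"

text \<open>Apart from the regularization, the loss is a sum of functions of differences of two coordinates
  of \<open>\<beta>\<close>, which is what the comparison principle asks for.\<close>

lemma gbt_loss_one_hot: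
  fixes x :: "real ^ 'a ^ 'd"
  assumes x: "\<And>d a. x $ d $ a = (if c a = d then 1 else 0)" and L: "laplacian L"
  shows "gbt_loss f \<sigma> x L D \<beta> = 1 / (2 * \<sigma>\<^sup>2) * (norm \<beta>)\<^sup>2
    + ((\<Sum>a\<in>UNIV. \<Sum>b\<in>UNIV. \<bar>L $ a $ b\<bar> / 4 * (\<beta> $ c a - \<beta> $ c b)\<^sup>2)
       + (\<Sum>s\<leftarrow>D. sample_loss f c s \<beta>))"
proof -
  have col: "column a x \<bullet> \<beta> = \<beta> $ c a" for a
    by (simp add: inner_vec_def column_def x if_distrib[of "\<lambda>t. t * _"] cong: if_cong)
  show ?thesis
    unfolding gbt_loss_def inner_diff_left col power2_norm_vec laplacian_quadratic_form[OF L]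
    by (simp add: sample_loss_def)
qed

lemma gbt_loss_ex1_minimizer:
  fixes x :: "real ^ 'a ^ 'd"
  assumes f: "root_law R f" and \<sigma>: "\<sigma> > 0" and L: "laplacian L"
    and x: "\<And>d a. x $ d $ a = (if c a = d then 1 else 0)"
  shows "\<exists>!v. \<forall>\<beta>. gbt_loss f \<sigma> x L D v \<le> gbt_loss f \<sigma> x L D \<beta>"
  unfolding gbt_loss_one_hot[OF x L]
proof (rule quadratic_plus_convex_ex1_minimizer)
  show "convex_on UNIV (\<lambda>\<beta> :: real ^ 'd.
      (\<Sum>a\<in>UNIV. \<Sum>b\<in>UNIV. \<bar>L $ a $ b\<bar> / 4 * (\<beta> $ c a - \<beta> $ c b)\<^sup>2)
       + (\<Sum>s\<leftarrow>D. sample_loss f c s \<beta>))"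
    unfolding sample_loss_def
    by (intro convex_on_add convex_on_pointwise_sum convex_on_sum_list)
      (auto intro!: convex_on_difference[OF convex_on_scaled_square] convex_on_pointwise_sum
        convex_on_difference[OF convex_on_tilted_cgf[OF f]] split: prod.split)
qed (use \<sigma> in simp)

lemma gbt_loss_transfer_stable:
  fixes x :: "real ^ 'a ^ 'd"
  assumes f: "root_law R f" and L: "laplacian L"
    and x: "\<And>d a. x $ d $ a = (if c a = d then 1 else 0)"
  shows "transfer_stable (gbt_loss f \<sigma> x L D)"
proof -
  have "transfer_stable (\<lambda>\<beta> :: real ^ 'd. \<Sum>d\<in>UNIV. 1 / (2 * \<sigma>\<^sup>2) * (\<beta> $ d)\<^sup>2)"
    by (intro transfer_stable_sum transfer_stable_coord[OF convex_on_scaled_square]) simp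
  then have "transfer_stable (\<lambda>\<beta> :: real ^ 'd. 1 / (2 * \<sigma>\<^sup>2) * (norm \<beta>)\<^sup>2)"
    by (simp only: power2_norm_vec sum_distrib_left)
  moreover have "transfer_stable (\<lambda>\<beta> :: real ^ 'd.
      \<Sum>a\<in>UNIV. \<Sum>b\<in>UNIV. \<bar>L $ a $ b\<bar> / 4 * (\<beta> $ c a - \<beta> $ c b)\<^sup>2)"
    by (intro transfer_stable_sum transfer_stable_difference[OF convex_on_scaled_square]) simp
  moreover have "transfer_stable (\<lambda>\<beta>. \<Sum>s\<leftarrow>D. sample_loss f c s \<beta>)"
    unfolding sample_loss_def
    by (intro transfer_stable_sum_list)
      (auto intro!: transfer_stable_difference[OF convex_on_tilted_cgf[OF f]] split: prod.split)
  ultimately have "transfer_stable (\<lambda>\<beta>. gbt_loss f \<sigma> x L D \<beta>)"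
    unfolding gbt_loss_one_hot[OF x L] by (intro transfer_stable_add)
  then show ?thesis .
qed

text \<open>Every elementary change of the dataset that matters adds to the loss an antitone function of
  the score difference of two classes; the comparison principle then applies to the two
  minimizers.\<close>

lemma gbt_minimizer_coord_mono:
  fixes x :: "real ^ 'a ^ 'd"
  assumes f: "root_law R f" and \<sigma>: "\<sigma> > 0" and L: "laplacian L"
    and x: "\<And>d a. x $ d $ a = (if c a = d then 1 else 0)"
    and h: "antimono h"
    and D': "\<And>\<beta>. gbt_loss f \<sigma> x L D' \<beta> = gbt_loss f \<sigma> x L D \<beta> + h (\<beta> $ i - \<beta> $ j)"
  shows "gbt_minimizer f \<sigma> x L D $ i \<le> gbt_minimizer f \<sigma> x L D' $ i"
proof (rule minimizer_coord_mono[OF gbt_loss_transfer_stable[OF f L x] h])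
  note ex1 = gbt_loss_ex1_minimizer[OF f \<sigma> L x]
  have min: "gbt_loss f \<sigma> x L E (gbt_minimizer f \<sigma> x L E) \<le> gbt_loss f \<sigma> x L E \<beta>" for E \<beta>
    using theI'[OF ex1] unfolding gbt_minimizer_def by blast
  show "\<beta> = gbt_minimizer f \<sigma> x L D"
    if "gbt_loss f \<sigma> x L D \<beta> \<le> gbt_loss f \<sigma> x L D (gbt_minimizer f \<sigma> x L D)" for \<beta>
    using ex1[of D] min[of D] order_trans[OF that min] by blast
  show "gbt_loss f \<sigma> x L D (gbt_minimizer f \<sigma> x L D')
      + h (gbt_minimizer f \<sigma> x L D' $ i - gbt_minimizer f \<sigma> x L D' $ j)
      \<le> gbt_loss f \<sigma> x L D \<beta> + h (\<beta> $ i - \<beta> $ j)" for \<beta>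
    using min[of D' \<beta>] unfolding D' .
qed


section \<open>Operations on datasets and monotonicity\<close>

text \<open>Exchanging a sample negates both its value and its score difference. The linear term is
  invariant under this, and the cumulant-generating function is even because the law is
  symmetric.\<close>

lemma sample_loss_swap:
  assumes "symmetric_values R" "root_law R f" "symmetric_law f"
  shows "sample_loss f c (swap_sample s) \<beta> = sample_loss f c s \<beta>"
proof (cases s)
  case (fields a b r)
  then show ?thesis
    using cgf_even[OF assms, of "\<beta> $ c a - \<beta> $ c b"]
    by (simp add: sample_loss_def algebra_simps)
qed

lemma sum_list_map_list_update:
  fixes g :: "'b \<Rightarrow> real"
  assumes "n < length D"
  shows "(\<Sum>s\<leftarrow>D[n := t]. g s) = (\<Sum>s\<leftarrow>D. g s) + (g t - g (D ! n))"
  using assms by (induction D arbitrary: n) (auto split: nat.split)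

lemma sum_list_exchange:
  fixes g :: "'a sample \<Rightarrow> real"
  assumes "\<And>s. g (swap_sample s) = g s"
  shows "(\<Sum>s\<leftarrow>exchange n D. g s) = (\<Sum>s\<leftarrow>D. g s)"
  by (simp add: exchange_def sum_list_map_list_update assms)

lemma sum_list_shuffle:
  fixes g :: "'a sample \<Rightarrow> real"
  assumes "p permutes {..<N}"
  shows "(\<Sum>s\<leftarrow>shuffle N p D. g s) = (\<Sum>s\<leftarrow>D. g s)"
proof (cases "N \<le> length D")
  case True
  have "mset (permute_list p (take N D)) = mset (take N D)"
    using assms True by (intro mset_permute_list) (simp add: min_absorb2)
  then have "mset (shuffle N p D) = mset D"
    using True mset_append[of "take N D" "drop N D"] by (simp add: shuffle_def)
  then have "mset (map g (shuffle N p D)) = mset (map g D)" by simp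
  then show ?thesis by (metis sum_mset_sum_list)
qed (simp add: shuffle_def)

text \<open>Exchanges and shuffles leave the loss unchanged. An append that definitely favors \<open>a\<close> adds
  \<open>cgf f z - m * z\<close>, where \<open>z\<close> is the score difference of \<open>a\<close> and the other alternative and \<open>m\<close> is
  the maximal value. An update in favor of \<open>a\<close> adds a nonpositive multiple of \<open>z\<close>. Both are
  antitone in \<open>z\<close>.\<close>

lemma GBT_one_hot_monotone:
  fixes x :: "real ^ 'a ^ 'd"
  assumes R: "symmetric_values R" and f: "root_law R f" and sym: "symmetric_law f"
    and \<sigma>: "\<sigma> > 0" and L: "laplacian L"
    and x: "\<And>d a. x $ d $ a = (if c a = d then 1 else 0)"
  shows "monotone_alg R (GBT f \<sigma> x L)"
proof -
  note swap = sample_loss_swap[OF R f sym]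
  note loss = gbt_loss_one_hot[OF x L]
  have score: "GBT f \<sigma> x L E $ a = gbt_minimizer f \<sigma> x L E $ c a" for E a
    by (simp add: GBT_def matrix_vector_mult_def transpose_def x
      if_distrib[of "\<lambda>t. t * _"] cong: if_cong)
  note step = gbt_minimizer_coord_mono[OF f \<sigma> L x]
  have same: "GBT f \<sigma> x L E = GBT f \<sigma> x L E'"
    if "\<And>\<beta>. (\<Sum>s\<leftarrow>E. sample_loss f c s \<beta>) = (\<Sum>s\<leftarrow>E'. sample_loss f c s \<beta>)" for E E'
    by (simp add: GBT_def gbt_minimizer_def loss that)
  have "GBT f \<sigma> x L D $ a \<le> GBT f \<sigma> x L D' $ a" if "favored_le R a D D'" for a D D'
    using that
  proof induction
    case (exchange D D' n)
    then show ?case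
      using same[OF sum_list_exchange[of "\<lambda>s. sample_loss f c s _", OF swap]] by simp
  next
    case (shuffle D D' p N)
    then show ?case using same[OF sum_list_shuffle] by simp
  next
    case (append D D' s b)
    then obtain m where m: "\<And>r. r \<in> R \<Longrightarrow> r \<le> m" and s: "equiv_sample s (a, b, m)"
      by (auto simp: append_definitely_favors_def)
    have "sample_loss f c s \<beta> = sample_loss f c (a, b, m) \<beta>" for \<beta>
      using s swap[of c s \<beta>] by (auto simp: equiv_sample_def)
    then have "gbt_minimizer f \<sigma> x L D' $ c a \<le> gbt_minimizer f \<sigma> x L (append_sample s D') $ c a"
      by (intro step[OF cgf_minus_max_antimono[OF f m]])
        (auto simp: loss append_sample_def sample_loss_def)
    then show ?case using append.IH unfolding score by linarith
  next
    case (update D D' r b n)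
    obtain p q t where pqt: "D' ! n = (p, q, t)" by (cases "D' ! n")
    have n: "n < length D'" and
      cases: "p = a \<and> q = b \<and> t \<le> r \<or> p = b \<and> q = a \<and> r \<le> t"
      using update.hyps pqt by (auto simp: update_favors_def)
    \<comment> \<open>The absolute value covers both orientations of the updated entry: the value grows if \<open>a\<close>
      comes first and shrinks if \<open>a\<close> comes second.\<close>
    have "antimono (\<lambda>z. - \<bar>r - t\<bar> * z)" by (rule antimonoI) (simp add: mult_left_mono)
    moreover have "sample_loss f c (p, q, r) \<beta> - sample_loss f c (p, q, t) \<beta>
        = - \<bar>r - t\<bar> * (\<beta> $ c a - \<beta> $ c b)" for \<beta>
      using cases by (auto simp: sample_loss_def algebra_simps)
    ultimately have "gbt_minimizer f \<sigma> x L D' $ c a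
        \<le> gbt_minimizer f \<sigma> x L (update_value n r D') $ c a"
      using n by (intro step) (auto simp: loss update_value_def pqt sum_list_map_list_update)
    then show ?case using update.IH unfolding score by linarith
  qed simp
  then show ?thesis by (simp add: monotone_alg_def)
qed


section \<open>Diffusion embeddings\<close>

text \<open>Let \<open>E\<close> be the indicator matrix of the relation of being in the same class, and let \<open>n a\<close> be the
  size of the class of \<open>a\<close>. Stacking \<open>s\<close> times the identity below \<open>x\<close> only shifts the parameter:
  the matrix to be inverted is \<open>E\<close> plus \<open>\<nu> = s\<^sup>2 + \<mu>\<close> on the diagonal. Since
  multiplying \<open>E\<close> by itself scales row \<open>a\<close> by \<open>n a\<close>, the inverse can be written down explicitly.
  Its off-diagonal entries are visibly nonpositive, and
  row \<open>a\<close> sums to \<open>1 / (\<nu> + n a)\<close>.\<close>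

lemma diffusion_embedding_stacked_one_hot:
  fixes x :: "real ^ 'a ^ 'd"
  assumes x: "\<And>d a. x $ d $ a = (if c a = d then 1 else 0)"
  shows "diffusion_embedding (vstack x (s *\<^sub>R (mat 1 :: real ^ 'a ^ 'a)))"
  unfolding diffusion_embedding_def
proof (intro allI impI)
  fix \<mu> :: real assume \<mu>: "\<mu> > 0"
  let ?y = "vstack x (s *\<^sub>R (mat 1 :: real ^ 'a ^ 'a))"
  define \<nu> where "\<nu> = s\<^sup>2 + \<mu>"
  have \<nu>: "\<nu> > 0" using \<mu> by (simp add: \<nu>_def add_nonneg_pos)
  define E :: "'a \<Rightarrow> 'a \<Rightarrow> real" where "E a b = (if c a = c b then 1 else 0)" for a b
  define n where "n a = (\<Sum>b\<in>UNIV. E a b)" for a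
  have n: "n a \<ge> 0" for a by (auto simp: n_def E_def intro: sum_nonneg)
  have n_cong: "E a b * n b = E a b * n a" for a b by (simp add: E_def n_def)
  have EE: "(\<Sum>b\<in>UNIV. E a b * E b d) = n a * E a d" for a d
    unfolding n_def sum_distrib_right by (intro sum.cong) (auto simp: E_def)
  define M :: "real ^ 'a ^ 'a" where "M = (\<chi> a b. E a b + (if a = b then \<nu> else 0))"
  define N :: "real ^ 'a ^ 'a" where
    "N = (\<chi> a b. ((if a = b then 1 else 0) - E a b / (\<nu> + n a)) / \<nu>)"
  have gram: "transpose ?y ** ?y + \<mu> *\<^sub>R mat 1 = M"
  proof -
    have "(transpose ?y ** ?y) $ a $ b = E a b + (if a = b then s\<^sup>2 else 0)" for a b
    proof -
      have "(transpose ?y ** ?y) $ a $ b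
          = (\<Sum>j\<in>UNIV. x $ j $ a * x $ j $ b)
            + (\<Sum>k\<in>UNIV. (s *\<^sub>R (mat 1 :: real ^ 'a ^ 'a)) $ k $ a * (s *\<^sub>R mat 1) $ k $ b)"
        by (simp add: matrix_matrix_mult_def transpose_def vstack_def sum.Plus
            UNIV_Plus_UNIV[symmetric] del: UNIV_Plus_UNIV)
      also have "(\<Sum>j\<in>UNIV. x $ j $ a * x $ j $ b) = E a b"
        by (simp add: x E_def if_distrib[of "\<lambda>t. t * _"] cong: if_cong)
      also have "(\<Sum>k\<in>UNIV. (s *\<^sub>R (mat 1 :: real ^ 'a ^ 'a)) $ k $ a * (s *\<^sub>R mat 1) $ k $ b)
          = (if a = b then s\<^sup>2 else 0)"
        by (simp add: mat_def if_distrib[of "\<lambda>t. t * _"] if_distrib[of "\<lambda>t. s * t"]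
            power2_eq_square cong: if_cong)
      finally show ?thesis .
    qed
    then show ?thesis by (auto simp: vec_eq_iff M_def \<nu>_def mat_def)
  qed
  have MN: "M ** N = mat 1"
  proof -
    have "(M ** N) $ a $ d = (if a = d then 1 else 0)" for a d
    proof -
      have "(M ** N) $ a $ d = (\<Sum>b\<in>UNIV. (E a b + (if a = b then \<nu> else 0))
          * (((if b = d then 1 else 0) - E b d / (\<nu> + n b)) / \<nu>))"
        by (simp add: matrix_matrix_mult_def M_def N_def)
      also have "\<dots> = (\<Sum>b\<in>UNIV. (if b = d then E a b / \<nu> else 0)
          - E a b * E b d / (\<nu> + n a) / \<nu>
          + (if a = b then (if b = d then 1 else 0) - E b d / (\<nu> + n b) else 0))"
      proof (intro sum.cong HOL.refl)
        fix b
        have "E a b * (E b d / (\<nu> + n b)) = E a b * E b d / (\<nu> + n a)"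
          using n_cong[of a b] by (cases "E a b = 0") (auto simp: E_def split: if_splits)
        moreover have "(E a b + (if a = b then \<nu> else 0)) * (((if b = d then 1 else 0) - g) / \<nu>)
          = (if b = d then E a b / \<nu> else 0) - E a b * g / \<nu>
          + (if a = b then (if b = d then 1 else 0) - g else 0)" for g
          using \<nu> by (auto simp: field_simps)
        ultimately show "(E a b + (if a = b then \<nu> else 0))
            * (((if b = d then 1 else 0) - E b d / (\<nu> + n b)) / \<nu>)
          = (if b = d then E a b / \<nu> else 0) - E a b * E b d / (\<nu> + n a) / \<nu>
          + (if a = b then (if b = d then 1 else 0) - E b d / (\<nu> + n b) else 0)"
          by (simp only:)
      qed
      also have "\<dots> = E a d / \<nu> - n a * E a d / (\<nu> + n a) / \<nu>
          + ((if a = d then 1 else 0) - E a d / (\<nu> + n a))"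
        by (simp add: sum.distrib sum_subtractf EE flip: sum_divide_distrib)
      also have "\<dots> = (if a = d then 1 else 0)"
      proof -
        have "\<nu> + n a > 0" using \<nu> n[of a] by linarith
        then show ?thesis using \<nu> by (auto simp: divide_simps) (auto simp: algebra_simps)
      qed
      finally show ?thesis .
    qed
    then show ?thesis by (simp add: vec_eq_iff mat_def)
  qed
  have NM: "N ** M = mat 1" using MN by (simp add: matrix_left_right_inverse)
  have inv: "invertible M" using MN NM by (auto simp: invertible_def)
  have "M ** matrix_inv M = mat 1" using inv unfolding invertible_def matrix_inv_def
    by (rule someI_ex[THEN conjunct1])
  then have "matrix_inv M = N"
    using NM by (metis matrix_mul_assoc matrix_mul_lid matrix_mul_rid)
  moreover have "super_laplacian N"
    unfolding super_laplacian_def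
  proof (intro conjI allI impI)
    show "transpose N = N"
      by (auto simp: vec_eq_iff N_def transpose_def E_def n_def)
    show "N $ a $ b \<le> 0" if "a \<noteq> b" for a b
      using that \<nu> n[of a] by (auto simp: N_def E_def divide_nonneg_nonneg)
    show "N $ a $ a > - (\<Sum>b\<in>UNIV - {a}. N $ a $ b)" for a
    proof -
      have pos: "\<nu> + n a > 0" using \<nu> n[of a] by linarith
      have "(\<Sum>b\<in>UNIV. N $ a $ b) = (1 - n a / (\<nu> + n a)) / \<nu>"
        by (simp add: N_def n_def sum_subtractf flip: sum_divide_distrib)
      also have "\<dots> > 0" using \<nu> pos by (intro divide_pos_pos) (simp_all add: pos_divide_less_eq)
      finally show ?thesis by (simp add: sum.remove[of UNIV a])
    qed
  qed
  ultimately show "invertible (transpose ?y ** ?y + \<mu> *\<^sub>R mat 1)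
      \<and> super_laplacian (matrix_inv (transpose ?y ** ?y + \<mu> *\<^sub>R mat 1))"
    unfolding gram using inv by simp
qed

theorem theorem2:
  fixes R :: "real set" and f :: "real measure" and \<sigma> s :: real
    and L :: "real ^ 'a ^ 'a" and x :: "real ^ 'a ^ 'd"
  assumes "symmetric_values R"
    and "root_law R f" and "symmetric_law f"
    and "\<sigma> > 0"
    and "laplacian L"
    and "one_hot x"
  shows "diffusion_embedding (vstack x (s *\<^sub>R (mat 1 :: real ^ 'a ^ 'a)))
    \<and> monotone_alg R (GBT f \<sigma> x L)"
proof -
  obtain c where x: "\<And>d a. x $ d $ a = (if c a = d then 1 else 0)"
    using assms(6) by (auto simp: one_hot_def)
  show ?thesis
    using diffusion_embedding_stacked_one_hot[OF x] GBT_one_hot_monotone[OF assms(1-5) x]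
    by blast
qed

end
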